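(* Let $\Delta$ be a simplicial complex of dimension $d-1$ on the vertex set $[n]$. Then $$L_k(\Delta)^{sq}\subseteq I(\Delta^{(d-k)})^\vee\quad\text{for all } k\in\{1,\ldots,d\}.$$ Furthermore, the following conditions are equivalent: (i) $\Delta$ is a pure simplicial complex; (ii) $L_k(\Delta)^{sq}=I(\Delta^{(d-k)})^\vee$ for some $k\in\{1,\ldots,d\}$ with $k\ne 1$; (iii) $L_k(\Delta)^{sq}=I(\Delta^{(d-k)})^\vee$ for all $k\in\{1,\ldots,d\}$.
   Context: Let $K$ be a field, $[n]=\{1,\ldots,n\}$ and $S=K[x_1,\ldots,x_n]$. A simplicial complex on $[n]$ is a nonempty collection of subsets (faces) of $[n]$ closed under taking subsets; facets are maximal faces, $\dim F=|F|-1$, $\dim\Delta$ is the maximal dimension of a face, and $\Delta$ is pure if all facets have the same dimension. The $i$-skeleton $\Delta^{(i)}$ is the simplicial complex of all faces $F\in\Delta$ with $\dim F\le i$. For $F\subseteq [n]$ put $x_F=\prod_{i\in F}x_i$ and let $P_F$ be the ideal generated by the $x_i$, $i\in F$. The facet ideal is $I(\Delta)=(x_F : F \text{ a facet of }\Delta)$, and its Alexander dual is $I(\Delta)^\vee=\bigcap_{F\text{ facet of }\Delta}P_F$ (the same notation is applied to $\Delta^{(i)}$). For an integer $k\ge 0$, a $k$-cover of $\Delta$ is a nonzero vector $c\in\mathbb{Z}_{\ge 0}^n$ with $\sum_{i\in F}c_i\ge k$ for every facet $F$; it is squarefree if all $c_i\le 1$. Write $x^c=x_1^{c_1}\cdots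 x_n^{c_n}$. $B(\Delta)\subseteq S[t]$ is the $S$-subalgebra generated by all $x^ct^k$ with $c$ a squarefree $k$-cover of $\Delta$; write $B(\Delta)=\bigoplus_{k\ge 0}L_k(\Delta)t^k$, where each $L_k(\Delta)$ is a monomial ideal of $S$. For a monomial ideal $I$, $I^{sq}$ is the ideal generated by all squarefree monomials in $I$.
   Formalization: The equivalence of (ii) with (i) and (iii) is stated for d ≥ 2 only, since for d ≤ 1 every complex is pure and (iii) holds, while (ii) fails because no k in {1,…,d} with k ≠ 1 exists; the inclusion and (i)⇔(iii) are for all d. *)

theory Defs
  imports "HOL-Library.Poly_Mapping" "HOL-Computational_Algebra.Polynomial"
begin

section \<open>Simplicial complexes\<close>

text \<open>
  The vertex set \<open>[n]\<close> is rendered by a finite type \<open>'n\<close>. An element of the type need not be a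
  vertex, that is, \<open>{i}\<close> need not be a face.
\<close>

definition simplicial_complex :: "'n set set \<Rightarrow> bool" where
  "simplicial_complex \<Delta> \<longleftrightarrow> \<Delta> \<noteq> {} \<and> (\<forall>F\<in>\<Delta>. \<forall>G. G \<subseteq> F \<longrightarrow> G \<in> \<Delta>)"

definition facets :: "'n set set \<Rightarrow> 'n set set" where
  "facets \<Delta> = {F \<in> \<Delta>. \<forall>G\<in>\<Delta>. F \<subseteq> G \<longrightarrow> G = F}"

text \<open>Dimensions are integers, since the empty face has dimension \<open>-1\<close>.\<close>

definition face_dim :: "'n set \<Rightarrow> int" where
  "face_dim F = int (card F) - 1"

definition complex_dim :: "'n set set \<Rightarrow> int" where
  "complex_dim \<Delta> = Max (face_dim ` \<Delta>)"

definition pure_complex :: "'n set set \<Rightarrow> bool" where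
  "pure_complex \<Delta> \<longleftrightarrow> (\<forall>F\<in>facets \<Delta>. \<forall>G\<in>facets \<Delta>. face_dim F = face_dim G)"

definition skeleton :: "int \<Rightarrow> 'n set set \<Rightarrow> 'n set set" where
  "skeleton i \<Delta> = {F \<in> \<Delta>. face_dim F \<le> i}"


section \<open>The polynomial ring and its monomial ideals\<close>

type_synonym ('n, 'k) mpoly = "('n \<Rightarrow>\<^sub>0 nat) \<Rightarrow>\<^sub>0 'k"

definition xmonom :: "('n \<Rightarrow>\<^sub>0 nat) \<Rightarrow> ('n, 'k::field) mpoly" where
  "xmonom c = Poly_Mapping.single c 1"

definition xvar :: "'n \<Rightarrow> ('n, 'k::field) mpoly" where
  "xvar i = xmonom (Poly_Mapping.single i 1)"

lemma module_times: "module ((*) :: 'a::comm_ring_1 \<Rightarrow> 'a \<Rightarrow> 'a)"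
  by unfold_locales (simp_all add: algebra_simps)

text \<open>The ideals of a commutative ring are its submodules.\<close>

definition ideal_gen :: "'a::comm_ring_1 set \<Rightarrow> 'a set" where
  "ideal_gen B = module.span (*) B"

definition prime_of_face :: "'n set \<Rightarrow> ('n, 'k::field) mpoly set" where
  "prime_of_face F = ideal_gen (xvar ` F)"

definition facet_ideal_dual :: "'n set set \<Rightarrow> ('n, 'k::field) mpoly set" where
  "facet_ideal_dual \<Delta> = (\<Inter>F\<in>facets \<Delta>. prime_of_face F)"

definition sqfree_vec :: "('n \<Rightarrow>\<^sub>0 nat) \<Rightarrow> bool" where
  "sqfree_vec c \<longleftrightarrow> (\<forall>i. Poly_Mapping.lookup c i \<le> 1)"

definition sqfree_part :: "('n, 'k::field) mpoly set \<Rightarrow> ('n, 'k) mpoly set" where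
  "sqfree_part I = ideal_gen {xmonom c | c. sqfree_vec c \<and> xmonom c \<in> I}"


section \<open>Vertex covers and the algebra they generate\<close>

definition is_cover :: "'n set set \<Rightarrow> nat \<Rightarrow> ('n \<Rightarrow>\<^sub>0 nat) \<Rightarrow> bool" where
  "is_cover \<Delta> k c \<longleftrightarrow> c \<noteq> 0 \<and> (\<forall>F\<in>facets \<Delta>. k \<le> (\<Sum>i\<in>F. Poly_Mapping.lookup c i))"

definition subalgebra :: "'a::comm_ring_1 poly set \<Rightarrow> bool" where
  "subalgebra A \<longleftrightarrow> (\<forall>s. [:s:] \<in> A) \<and> (\<forall>p\<in>A. \<forall>q\<in>A. p + q \<in> A \<and> p * q \<in> A)"

definition cover_algebra :: "'n set set \<Rightarrow> ('n, 'k::field) mpoly poly set" where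
  "cover_algebra \<Delta> =
     subalgebra hull {monom (xmonom c) k | c k. sqfree_vec c \<and> is_cover \<Delta> k c}"

definition cover_ideal :: "'n set set \<Rightarrow> nat \<Rightarrow> ('n, 'k::field) mpoly set" where
  "cover_ideal \<Delta> k = {f. monom f k \<in> cover_algebra \<Delta>}"

text \<open>
  The algebra is generated by homogeneous elements, so that \<open>B(\<Delta>)\<close> is indeed the direct sum of
  the components \<open>L\<^sub>k(\<Delta>) t\<^sup>k\<close>, and each \<open>L\<^sub>k(\<Delta>)\<close> is an ideal.
\<close>

lemma subalgebra_cover_algebra: "subalgebra (cover_algebra \<Delta>)"
  unfolding cover_algebra_def by (rule hull_in) (auto simp: subalgebra_def)

lemma cover_algebra_iff: "p \<in> cover_algebra \<Delta> \<longleftrightarrow> (\<forall>k. coeff p k \<in> cover_ideal \<Delta> k)"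
proof
  let ?B = "cover_algebra \<Delta> :: ('a, 'b) mpoly poly set"
  let ?A = "{p. \<forall>k. monom (coeff p k) k \<in> ?B}"
  have zero: "0 \<in> ?B"
    using subalgebra_cover_algebra[of \<Delta>] unfolding subalgebra_def by (metis pCons_0_0)
  have add: "p + q \<in> ?B" if "p \<in> ?B" "q \<in> ?B" for p q
    using that subalgebra_cover_algebra[of \<Delta>] by (auto simp: subalgebra_def)
  have mult: "p * q \<in> ?B" if "p \<in> ?B" "q \<in> ?B" for p q
    using that subalgebra_cover_algebra[of \<Delta>] by (auto simp: subalgebra_def)
  have sum: "sum f I \<in> ?B" if "\<And>i. i \<in> I \<Longrightarrow> f i \<in> ?B" for f :: "nat \<Rightarrow> _" and I
    using that by (induction I rule: infinite_finite_induct) (auto intro: zero add)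
  {
    assume "p \<in> ?B"
    moreover have "?B \<subseteq> ?A"
    proof (subst cover_algebra_def, rule hull_minimal)
      show "{monom (xmonom c) k | c k. sqfree_vec c \<and> is_cover \<Delta> k c} \<subseteq> ?A"
      proof clarify
        fix c k j assume "sqfree_vec c" "is_cover \<Delta> k c"
        then have "monom (xmonom c) k \<in> ?B"
          unfolding cover_algebra_def by (intro hull_inc) blast
        then show "monom (coeff (monom (xmonom c) k) j) j \<in> ?B"
          using zero by (cases "j = k") auto
      qed
      have const: "monom (coeff [:s:] k) k \<in> ?B" for s k
        using zero subalgebra_cover_algebra[of \<Delta>]
        by (cases k) (auto simp: subalgebra_def monom_0)
      have "monom (coeff (p * q) k) k \<in> ?B" if "p \<in> ?A" "q \<in> ?A" for p q k
      proof -
        have "monom (coeff (p * q) k) k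
            = (\<Sum>i\<le>k. monom (coeff p i) i * monom (coeff q (k - i)) (k - i))"
          by (simp add: coeff_mult monom_sum mult_monom)
        also have "\<dots> \<in> ?B" using that by (intro sum mult) auto
        finally show ?thesis .
      qed
      then show "subalgebra ?A"
        using const add by (auto simp: subalgebra_def add_monom[symmetric])
    qed
    ultimately show "\<forall>k. coeff p k \<in> cover_ideal \<Delta> k"
      by (auto simp: cover_ideal_def)
  }
  {
    assume "\<forall>k. coeff p k \<in> cover_ideal \<Delta> k"
    then have "(\<Sum>i\<le>degree p. monom (coeff p i) i) \<in> ?B"
      by (intro sum) (auto simp: cover_ideal_def)
    then show "p \<in> ?B" by (simp add: poly_as_sum_of_monoms)
  }
qed

lemma ideal_gen_cover_ideal: "ideal_gen (cover_ideal \<Delta> k) = cover_ideal \<Delta> k"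
proof -
  interpret module "(*) :: ('a, 'b) mpoly \<Rightarrow> ('a, 'b) mpoly \<Rightarrow> ('a, 'b) mpoly"
    by (rule module_times)
  have alg: "subalgebra (cover_algebra \<Delta> :: ('a, 'b) mpoly poly set)"
    by (rule subalgebra_cover_algebra)
  have "subspace (cover_ideal \<Delta> k :: ('a, 'b) mpoly set)"
  proof (rule subspaceI)
    show "0 \<in> (cover_ideal \<Delta> k :: ('a, 'b) mpoly set)"
      using alg unfolding subalgebra_def cover_ideal_def
      by (metis (no_types, lifting) mem_Collect_eq monom_eq_0 pCons_0_0)
    show "f + g \<in> cover_ideal \<Delta> k"
      if "f \<in> cover_ideal \<Delta> k" "g \<in> cover_ideal \<Delta> k" for f g :: "('a, 'b) mpoly"
      using that alg by (auto simp: subalgebra_def cover_ideal_def add_monom[symmetric])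
    show "s * f \<in> cover_ideal \<Delta> k" if "f \<in> cover_ideal \<Delta> k" for s f :: "('a, 'b) mpoly"
    proof -
      have "[:s:] * monom f k \<in> cover_algebra \<Delta>"
        using that alg unfolding subalgebra_def cover_ideal_def by blast
      then show ?thesis by (simp add: cover_ideal_def smult_monom)
    qed
  qed
  then show ?thesis by (simp add: ideal_gen_def span_eq_iff)
qed

end

theory Submission
  imports Defs
begin

text \<open>
  Both ideals are generated by squarefree monomials, so each is determined by a family of sets:
  a polynomial lies in it if and only if the support of each of its monomials belongs to the
  family. For \<open>L\<^sub>k(\<Delta>)\<^sup>s\<^sup>q\<close> the family consists of the \<open>C\<close> with \<open>\<bar>C \<inter> F\<bar> \<ge> k\<close> for all facets \<open>F\<close> of \<open>\<Delta>\<close>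
  (\<open>sqfree_part_cover_ideal\<close>): a product of generators \<open>x\<^sup>c t\<^sup>j\<close> of \<open>B(\<Delta>)\<close> has as exponent a sum of
  covers, hence a cover of the total order, and so decomposing \<open>k\<close> gives no new squarefree monomial.
  For \<open>I(\<Delta>\<^sup>(\<^sup>d\<^sup>-\<^sup>k\<^sup>))\<^sup>\<or>\<close> it consists of the \<open>C\<close> that meet every facet of the skeleton
  (\<open>facet_ideal_dual_eq\<close>). It remains to compare the two families.

  A facet of the skeleton has \<open>d - k + 1\<close> elements or is already a facet of \<open>\<Delta>\<close>. In the first case
  it misses at most \<open>k - 1\<close> elements of a facet \<open>F\<close> of \<open>\<Delta>\<close> around it, so a set with \<open>k\<close> elements in
  \<open>F\<close> meets it. If \<open>\<Delta>\<close> is pure and \<open>C\<close> has fewer than \<open>k\<close> elements in some facet \<open>F\<close>, then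
  \<open>F - C\<close> contains a face with \<open>d - k + 1\<close> elements, which \<open>C\<close> does not meet. If \<open>\<Delta>\<close> is not pure,
  a facet \<open>F\<close> with fewer than \<open>d\<close> elements separates the families for every \<open>k \<ge> 2\<close>: the complement
  of a suitable proper subset \<open>H\<close> of \<open>F\<close> meets all facets of the skeleton but has fewer
  than \<open>k\<close> elements in \<open>F\<close> (\<open>pure_if_transversals_are_covers\<close>).
\<close>

section \<open>Facets and skeletons\<close>

lemma face_in_facet:
  fixes \<Delta> :: "'n::finite set set"
  assumes "G \<in> \<Delta>"
  shows "\<exists>F\<in>facets \<Delta>. G \<subseteq> F"
proof -
  obtain F where "F \<in> \<Delta>" "G \<subseteq> F" "\<forall>H\<in>\<Delta>. F \<subseteq> H \<longrightarrow> F = H"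
    using finite_has_maximal2[OF finite[of \<Delta>] assms] by blast
  then show ?thesis by (auto simp: facets_def)
qed

lemma complex_dim_eqD:
  fixes \<Delta> :: "'n::finite set set"
  assumes "simplicial_complex \<Delta>" "complex_dim \<Delta> = int d - 1"
  shows "\<And>F. F \<in> \<Delta> \<Longrightarrow> card F \<le> d" and "\<exists>F\<in>facets \<Delta>. card F = d"
proof -
  have ne: "face_dim ` \<Delta> \<noteq> {}" using assms(1) by (auto simp: simplicial_complex_def)
  have le: "card F \<le> d" if "F \<in> \<Delta>" for F
  proof -
    have "face_dim F \<le> complex_dim \<Delta>"
      unfolding complex_dim_def using that by (intro Max_ge) auto
    then show ?thesis using assms(2) by (simp add: face_dim_def)
  qed
  then show "\<And>F. F \<in> \<Delta> \<Longrightarrow> card F \<le> d" .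
  have "complex_dim \<Delta> \<in> face_dim ` \<Delta>"
    unfolding complex_dim_def using ne by (intro Max_in) auto
  then obtain F where F: "F \<in> \<Delta>" "card F = d"
    using assms(2) by (auto simp: face_dim_def)
  obtain F' where F': "F' \<in> facets \<Delta>" "F \<subseteq> F'" using face_in_facet[OF F(1)] by blast
  have "card F' \<le> d" using F' le by (auto simp: facets_def)
  moreover have "card F \<le> card F'" using F' by (intro card_mono) auto
  ultimately show "\<exists>F\<in>facets \<Delta>. card F = d" using F F' by auto
qed

lemma mem_skeleton_iff:
  "F \<in> skeleton (int d - int k) \<Delta> \<longleftrightarrow> F \<in> \<Delta> \<and> card F + k \<le> d + 1"
  by (auto simp: skeleton_def face_dim_def)

text \<open>A face below the dimension bound can be enlarged by any element of a larger face without
  leaving the skeleton.\<close>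

lemma skeleton_facet_cases:
  fixes \<Delta> :: "'n::finite set set"
  assumes "simplicial_complex \<Delta>" "G \<in> facets (skeleton (int d - int k) \<Delta>)"
  shows "G \<in> facets \<Delta> \<or> card G + k = d + 1"
proof (rule disjCI)
  assume ncard: "card G + k \<noteq> d + 1"
  have G: "G \<in> \<Delta>" "card G + k \<le> d + 1"
    and max: "\<And>H. H \<in> \<Delta> \<Longrightarrow> card H + k \<le> d + 1 \<Longrightarrow> G \<subseteq> H \<Longrightarrow> H = G"
    using assms(2) by (auto simp: facets_def mem_skeleton_iff)
  have "H = G" if "H \<in> \<Delta>" "G \<subseteq> H" for H
  proof (rule ccontr)
    assume "H \<noteq> G"
    then obtain a where a: "a \<in> H" "a \<notin> G" using \<open>G \<subseteq> H\<close> by blast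
    then have "insert a G \<in> \<Delta>"
      using assms(1) that unfolding simplicial_complex_def by blast
    then have "insert a G = G" using a G ncard by (intro max) auto
    then show False using a by blast
  qed
  then show "G \<in> facets \<Delta>" using G by (auto simp: facets_def)
qed

section \<open>Covers of a complex and transversals of its skeletons\<close>

definition cover_sets :: "'n set set \<Rightarrow> nat \<Rightarrow> 'n set set" where
  "cover_sets \<Delta> k = {C. \<forall>F\<in>facets \<Delta>. k \<le> card (F \<inter> C)}"

definition transversals :: "'n set set \<Rightarrow> 'n set set" where
  "transversals \<F> = {C. \<forall>F\<in>\<F>. F \<inter> C \<noteq> {}}"

lemma cover_sets_subset_transversals:
  fixes \<Delta> :: "'n::finite set set"
  assumes "simplicial_complex \<Delta>" and le: "\<And>F. F \<in> \<Delta> \<Longrightarrow> card F \<le> d" and k: "1 \<le> k"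
  shows "cover_sets \<Delta> k \<subseteq> transversals (facets (skeleton (int d - int k) \<Delta>))"
proof -
  have "G \<inter> C \<noteq> {}"
    if C: "C \<in> cover_sets \<Delta> k" and G: "G \<in> facets (skeleton (int d - int k) \<Delta>)" for C G
  proof
    assume disj: "G \<inter> C = {}"
    obtain F where F: "F \<in> facets \<Delta>" "G \<subseteq> F"
      using face_in_facet[of G \<Delta>] G by (auto simp: facets_def mem_skeleton_iff)
    have kF: "k \<le> card (F \<inter> C)" using C F by (auto simp: cover_sets_def)
    show False using skeleton_facet_cases[OF assms(1) G]
    proof
      assume "G \<in> facets \<Delta>"
      then have "k \<le> card (G \<inter> C)" using C by (auto simp: cover_sets_def)
      then show False using disj k by simp
    next
      assume card_G: "card G + k = d + 1"
      have "card G + card (F \<inter> C) = card (G \<union> (F \<inter> C))"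
        using disj by (intro card_Un_disjoint[symmetric]) auto
      also have "\<dots> \<le> card F" using F by (intro card_mono) auto
      also have "\<dots> \<le> d" using F le by (auto simp: facets_def)
      finally show False using kF card_G by linarith
    qed
  qed
  then show ?thesis by (auto simp: transversals_def)
qed

lemma transversals_subset_cover_sets:
  fixes \<Delta> :: "'n::finite set set"
  assumes "simplicial_complex \<Delta>" and card_F: "\<And>F. F \<in> facets \<Delta> \<Longrightarrow> card F = d" and k: "k \<le> d"
  shows "transversals (facets (skeleton (int d - int k) \<Delta>)) \<subseteq> cover_sets \<Delta> k"
proof -
  have "k \<le> card (F \<inter> C)"
    if C: "C \<in> transversals (facets (skeleton (int d - int k) \<Delta>))" and F: "F \<in> facets \<Delta>" for C F
  proof (rule ccontr)
    assume "\<not> k \<le> card (F \<inter> C)"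
    then have "d + 1 - k \<le> card (F - C)"
      using card_F[OF F] card_Diff_subset_Int[of F C] by simp
    then obtain G where G: "G \<subseteq> F - C" "card G = d + 1 - k"
      by (meson obtain_subset_with_card_n)
    then have "G \<in> \<Delta>"
      using F assms(1) unfolding simplicial_complex_def facets_def by blast
    moreover have "H = G" if "card H + k \<le> d + 1" "G \<subseteq> H" for H
      using card_seteq[of H G] that G k by simp
    ultimately have "G \<in> facets (skeleton (int d - int k) \<Delta>)"
      using G k by (auto simp: facets_def mem_skeleton_iff)
    then show False using C G by (auto simp: transversals_def)
  qed
  then show ?thesis by (auto simp: cover_sets_def)
qed

text \<open>
  Suppose that a facet \<open>F\<close> has fewer than \<open>d\<close> elements. A proper subset \<open>H\<close> of \<open>F\<close> with at most
  \<open>d - k\<close> elements contains no facet of the skeleton, since \<open>H\<close> and one more element of \<open>F\<close> form a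
  larger face of the skeleton; thus \<open>- H\<close> is a transversal. It is not a cover if
  \<open>\<bar>F - H\<bar> < k\<close>. For the largest such \<open>H\<close>, \<open>\<bar>F - H\<bar>\<close> is the larger of \<open>\<bar>F\<bar> - (d - k)\<close> and \<open>1\<close>, and
  this is where both \<open>\<bar>F\<bar> < d\<close> and \<open>k \<ge> 2\<close> enter.
\<close>

lemma pure_if_transversals_are_covers:
  fixes \<Delta> :: "'n::finite set set"
  assumes "simplicial_complex \<Delta>" and k: "2 \<le> k" "k \<le> d"
    and sub: "transversals (facets (skeleton (int d - int k) \<Delta>)) \<subseteq> cover_sets \<Delta> k"
    and F: "F \<in> facets \<Delta>" "F \<noteq> {}"
  shows "d \<le> card F"
proof (rule ccontr)
  assume "\<not> d \<le> card F"
  then have small: "card F < d" by simp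
  have pos: "0 < card F" using F by (simp add: card_gt_0_iff)
  have "min (d - k) (card F - 1) \<le> card F" by simp
  then obtain H where H: "H \<subseteq> F" "card H = min (d - k) (card F - 1)"
    by (meson obtain_subset_with_card_n)
  then have "card H < card F" using pos by simp
  then obtain a where a: "a \<in> F" "a \<notin> H" using H(1) by (metis less_irrefl subset_antisym subsetI)
  have "F \<in> \<Delta>" "insert a H \<subseteq> F" using F(1) H(1) a by (auto simp: facets_def)
  then have "insert a H \<in> \<Delta>" using assms(1) by (simp add: simplicial_complex_def)
  then have face: "insert a H \<in> skeleton (int d - int k) \<Delta>"
    using H a k by (simp add: mem_skeleton_iff)
  have "G \<inter> - H \<noteq> {}" if "G \<in> facets (skeleton (int d - int k) \<Delta>)" for G
  proof
    assume "G \<inter> - H = {}"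
    then have "G \<subseteq> insert a H" "a \<notin> G" using a by auto
    then show False using that face by (auto simp: facets_def)
  qed
  then have "- H \<in> cover_sets \<Delta> k" using sub by (auto simp: transversals_def)
  then have "k \<le> card (F \<inter> - H)" using F by (auto simp: cover_sets_def)
  also have "F \<inter> - H = F - H" by blast
  also have "card (F - H) = card F - card H" using H(1) by (simp add: card_Diff_subset)
  finally show False using H(2) small k pos by simp
qed

section \<open>Ideals generated by monomials\<close>

lemma xmonom_mult: "xmonom a * xmonom b = xmonom (a + b)"
  by (simp add: xmonom_def mult_single)

lemma keys_xmonom [simp]: "Poly_Mapping.keys (xmonom c) = {c}"
  by (simp add: xmonom_def)

lemma sum_monomials_eq:
  "(\<Sum>m\<in>Poly_Mapping.keys f. Poly_Mapping.single m (Poly_Mapping.lookup f m)) = f"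
  by (rule poly_mapping_eqI)
    (simp add: lookup_sum lookup_single when_def sum.delta in_keys_iff)

lemma mem_monomial_ideal_iff:
  fixes f :: "('n, 'k::field) mpoly"
  shows "f \<in> ideal_gen (xmonom ` M) \<longleftrightarrow> (\<forall>m\<in>Poly_Mapping.keys f. \<exists>a\<in>M. \<exists>b. m = a + b)"
proof -
  interpret module "(*) :: ('n, 'k) mpoly \<Rightarrow> ('n, 'k) mpoly \<Rightarrow> ('n, 'k) mpoly"
    by (rule module_times)
  let ?A = "{f :: ('n, 'k) mpoly. \<forall>m\<in>Poly_Mapping.keys f. \<exists>a\<in>M. \<exists>b. m = a + b}"
  show ?thesis
  proof
    have "subspace ?A"
    proof (rule subspaceI)
      show "f + g \<in> ?A" if "f \<in> ?A" "g \<in> ?A" for f g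
        using that Poly_Mapping.keys_add[of f g] by blast
      show "s * f \<in> ?A" if f: "f \<in> ?A" for s f
      proof clarify
        fix m assume "m \<in> Poly_Mapping.keys (s * f)"
        then obtain u v where m: "m = u + v" "v \<in> Poly_Mapping.keys f" using keys_mult[of s f] by auto
        then obtain a b where "a \<in> M" "v = a + b" using f by blast
        then have "a \<in> M" "m = a + (u + b)" using m by (simp_all add: algebra_simps)
        then show "\<exists>a\<in>M. \<exists>b. m = a + b" by blast
      qed
    qed simp
    moreover have "xmonom ` M \<subseteq> ?A" by (auto intro!: bexI exI[of _ 0])
    ultimately have "ideal_gen (xmonom ` M) \<subseteq> ?A"
      unfolding ideal_gen_def by (intro span_minimal)
    then show "\<forall>m\<in>Poly_Mapping.keys f. \<exists>a\<in>M. \<exists>b. m = a + b" if "f \<in> ideal_gen (xmonom ` M)"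
      using that by blast
  next
    assume *: "\<forall>m\<in>Poly_Mapping.keys f. \<exists>a\<in>M. \<exists>b. m = a + b"
    have "Poly_Mapping.single m (Poly_Mapping.lookup f m) \<in> span (xmonom ` M)"
      if m: "m \<in> Poly_Mapping.keys f" for m
    proof -
      obtain a b where ab: "a \<in> M" "m = a + b" using * m by blast
      have "Poly_Mapping.single m (Poly_Mapping.lookup f m)
          = Poly_Mapping.single b (Poly_Mapping.lookup f m) * xmonom a"
        by (simp add: xmonom_def mult_single ab add.commute)
      then show ?thesis using ab(1) by (metis imageI span_base span_scale)
    qed
    then have "(\<Sum>m\<in>Poly_Mapping.keys f. Poly_Mapping.single m (Poly_Mapping.lookup f m))
        \<in> span (xmonom ` M)"
      by (rule span_sum)
    then show "f \<in> ideal_gen (xmonom ` M)"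
      by (simp add: ideal_gen_def sum_monomials_eq)
  qed
qed

text \<open>For a family that is closed under supersets, this is the ideal generated by the squarefree
  monomials whose supports lie in the family.\<close>

definition polys_supported_in :: "'n set set \<Rightarrow> ('n, 'k::field) mpoly set" where
  "polys_supported_in \<C> = {f. \<forall>m\<in>Poly_Mapping.keys f. Poly_Mapping.keys m \<in> \<C>}"

definition sqfree_exponent :: "'n::finite set \<Rightarrow> 'n \<Rightarrow>\<^sub>0 nat" where
  "sqfree_exponent C = Abs_poly_mapping (\<lambda>i. of_bool (i \<in> C))"

lemma lookup_sqfree_exponent [simp]: "Poly_Mapping.lookup (sqfree_exponent C) i = of_bool (i \<in> C)"
  by (simp add: sqfree_exponent_def)

lemma keys_sqfree_exponent [simp]: "Poly_Mapping.keys (sqfree_exponent C) = C"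
  by (auto simp: in_keys_iff)

lemma sqfree_vec_sqfree_exponent [simp]: "sqfree_vec (sqfree_exponent C)"
  by (simp add: sqfree_vec_def)

lemma sum_lookup_sqfree_vec:
  fixes F :: "'n::finite set"
  assumes "sqfree_vec c"
  shows "(\<Sum>i\<in>F. Poly_Mapping.lookup c i) = card (F \<inter> Poly_Mapping.keys c)"
proof -
  have "Poly_Mapping.lookup c i = of_bool (i \<in> Poly_Mapping.keys c)" for i
    using assms[unfolded sqfree_vec_def, rule_format, of i] by (auto simp: in_keys_iff)
  then show ?thesis by simp
qed

lemma keys_add_nat: "Poly_Mapping.keys (a + b) = Poly_Mapping.keys a \<union> Poly_Mapping.keys b"
  for a b :: "'n \<Rightarrow>\<^sub>0 nat"
  by (auto simp: in_keys_iff lookup_add)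

lemma polys_supported_in_subset_iff:
  fixes \<C> \<D> :: "'n::finite set set"
  shows "(polys_supported_in \<C> :: ('n, 'k::field) mpoly set) \<subseteq> polys_supported_in \<D> \<longleftrightarrow> \<C> \<subseteq> \<D>"
proof
  assume sub: "(polys_supported_in \<C> :: ('n, 'k) mpoly set) \<subseteq> polys_supported_in \<D>"
  show "\<C> \<subseteq> \<D>"
  proof
    fix C assume "C \<in> \<C>"
    then have "(xmonom (sqfree_exponent C) :: ('n, 'k) mpoly) \<in> polys_supported_in \<C>"
      by (simp add: polys_supported_in_def)
    then have "(xmonom (sqfree_exponent C) :: ('n, 'k) mpoly) \<in> polys_supported_in \<D>"
      using sub by blast
    then show "C \<in> \<D>" by (simp add: polys_supported_in_def)
  qed
qed (auto simp: polys_supported_in_def)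

lemma facet_ideal_dual_eq:
  "facet_ideal_dual \<Delta> = polys_supported_in (transversals (facets \<Delta>))"
proof -
  have "f \<in> prime_of_face F \<longleftrightarrow> (\<forall>m\<in>Poly_Mapping.keys f. F \<inter> Poly_Mapping.keys m \<noteq> {})"
    for f :: "('a, 'b::field) mpoly" and F
  proof -
    have divides: "(\<exists>b. m = Poly_Mapping.single i 1 + b) \<longleftrightarrow> i \<in> Poly_Mapping.keys m"
      for i and m :: "'a \<Rightarrow>\<^sub>0 nat"
    proof
      assume "i \<in> Poly_Mapping.keys m"
      then have "m = Poly_Mapping.single i 1 + (m - Poly_Mapping.single i 1)"
        by (intro poly_mapping_eqI) (auto simp: lookup_add lookup_minus lookup_single when_def in_keys_iff)
      then show "\<exists>b. m = Poly_Mapping.single i 1 + b" by blast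
    qed (auto simp: keys_add_nat)
    have gens: "xvar ` F = xmonom ` (\<lambda>i. Poly_Mapping.single i 1) ` F"
      by (auto simp: xvar_def image_image)
    have "f \<in> prime_of_face F
        \<longleftrightarrow> (\<forall>m\<in>Poly_Mapping.keys f. \<exists>i\<in>F. \<exists>b. m = Poly_Mapping.single i 1 + b)"
      unfolding prime_of_face_def gens mem_monomial_ideal_iff by simp
    then show ?thesis by (auto simp only: divides)
  qed
  then show ?thesis
    by (auto simp: facet_ideal_dual_def polys_supported_in_def transversals_def)
qed

section \<open>Squarefree monomials in the cover ideals\<close>

text \<open>The polynomials in \<open>t\<close> all of whose exponents satisfy the cover inequalities form an algebra,
  because the inequalities of orders \<open>i\<close> and \<open>j\<close> add up to those of order \<open>i + j\<close>.\<close>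

lemma cover_inequality_cover_ideal:
  fixes f :: "('n, 'k::field) mpoly"
  assumes "f \<in> cover_ideal \<Delta> k" "m \<in> Poly_Mapping.keys f" "F \<in> facets \<Delta>"
  shows "k \<le> (\<Sum>i\<in>F. Poly_Mapping.lookup m i)"
proof -
  let ?w = "\<lambda>m. \<Sum>i\<in>F. Poly_Mapping.lookup m i"
  let ?A = "{p :: ('n, 'k) mpoly poly. \<forall>k. \<forall>m\<in>Poly_Mapping.keys (coeff p k). k \<le> ?w m}"
  have "cover_algebra \<Delta> \<subseteq> ?A"
  proof (subst cover_algebra_def, rule hull_minimal)
    show "{monom (xmonom c) k | c k. sqfree_vec c \<and> is_cover \<Delta> k c} \<subseteq> ?A"
      using assms(3) by (auto simp: is_cover_def split: if_splits)
    have "[:s:] \<in> ?A" for s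
      by (auto simp: coeff_pCons split: nat.splits)
    moreover have "p + q \<in> ?A" if "p \<in> ?A" "q \<in> ?A" for p q
      using that Poly_Mapping.keys_add by (fastforce simp del: lookup_add)
    moreover have "p * q \<in> ?A" if p: "p \<in> ?A" and q: "q \<in> ?A" for p q
    proof clarify
      fix k m assume "m \<in> Poly_Mapping.keys (coeff (p * q) k)"
      then obtain j where j: "j \<le> k" "m \<in> Poly_Mapping.keys (coeff p j * coeff q (k - j))"
        using keys_sum[of "\<lambda>j. coeff p j * coeff q (k - j)" "{..k}"] by (auto simp: coeff_mult)
      then obtain u v where uv: "u \<in> Poly_Mapping.keys (coeff p j)"
          "v \<in> Poly_Mapping.keys (coeff q (k - j))" "m = u + v"
        using keys_mult[of "coeff p j" "coeff q (k - j)"] by auto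
      then have "j \<le> ?w u" "k - j \<le> ?w v" using p q by auto
      then show "k \<le> ?w m" using uv j by (simp add: lookup_add sum.distrib)
    qed
    ultimately show "subalgebra ?A" unfolding subalgebra_def by blast
  qed
  then have "monom f k \<in> ?A" using assms(1) by (auto simp: cover_ideal_def)
  then show ?thesis using assms(2) by (force split: if_splits)
qed

lemma sqfree_xmonom_mem_cover_ideal_iff:
  fixes \<Delta> :: "'n::finite set set"
  assumes "facets \<Delta> \<noteq> {}" "1 \<le> k" "sqfree_vec c"
  shows "(xmonom c :: ('n, 'k::field) mpoly) \<in> cover_ideal \<Delta> k \<longleftrightarrow> Poly_Mapping.keys c \<in> cover_sets \<Delta> k"
proof
  assume "(xmonom c :: ('n, 'k) mpoly) \<in> cover_ideal \<Delta> k"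
  then show "Poly_Mapping.keys c \<in> cover_sets \<Delta> k"
    using cover_inequality_cover_ideal[of "xmonom c :: ('n, 'k) mpoly" \<Delta> k c]
    by (auto simp: cover_sets_def simp flip: sum_lookup_sqfree_vec[OF assms(3)])
next
  assume C: "Poly_Mapping.keys c \<in> cover_sets \<Delta> k"
  have "c \<noteq> 0" using C assms by (auto simp: cover_sets_def)
  then have "is_cover \<Delta> k c"
    using C by (simp add: is_cover_def cover_sets_def sum_lookup_sqfree_vec[OF assms(3)])
  then show "(xmonom c :: ('n, 'k) mpoly) \<in> cover_ideal \<Delta> k"
    unfolding cover_ideal_def cover_algebra_def using assms(3)
    by (auto intro!: hull_inc)
qed

lemma sqfree_part_cover_ideal:
  fixes \<Delta> :: "'n::finite set set"
  assumes "facets \<Delta> \<noteq> {}" "1 \<le> k"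
  shows "(sqfree_part (cover_ideal \<Delta> k) :: ('n, 'k::field) mpoly set)
           = polys_supported_in (cover_sets \<Delta> k)"
proof -
  let ?M = "{c. sqfree_vec c \<and> Poly_Mapping.keys c \<in> cover_sets \<Delta> k}"
  have gens: "{xmonom c | c. sqfree_vec c \<and> (xmonom c :: ('n, 'k) mpoly) \<in> cover_ideal \<Delta> k}
      = xmonom ` ?M"
    using sqfree_xmonom_mem_cover_ideal_iff[OF assms] by auto
  have supp: "(\<exists>a\<in>?M. \<exists>b. m = a + b) \<longleftrightarrow> Poly_Mapping.keys m \<in> cover_sets \<Delta> k"
    for m :: "'n \<Rightarrow>\<^sub>0 nat"
  proof
    assume "\<exists>a\<in>?M. \<exists>b. m = a + b"
    then obtain a b where a: "Poly_Mapping.keys a \<in> cover_sets \<Delta> k" and m: "m = a + b" by auto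
    have "card (F \<inter> Poly_Mapping.keys a) \<le> card (F \<inter> Poly_Mapping.keys m)" for F
      using m by (intro card_mono) (auto simp: keys_add_nat)
    then show "Poly_Mapping.keys m \<in> cover_sets \<Delta> k"
      using a order_trans unfolding cover_sets_def by blast
  next
    assume m: "Poly_Mapping.keys m \<in> cover_sets \<Delta> k"
    have "m = sqfree_exponent (Poly_Mapping.keys m) + (m - sqfree_exponent (Poly_Mapping.keys m))"
      by (intro poly_mapping_eqI) (auto simp: lookup_add lookup_minus in_keys_iff)
    then show "\<exists>a\<in>?M. \<exists>b. m = a + b"
      using m by (intro bexI[of _ "sqfree_exponent (Poly_Mapping.keys m)"]) auto
  qed
  show ?thesis
    unfolding sqfree_part_def polys_supported_in_def gens
    by (intro set_eqI) (unfold mem_monomial_ideal_iff supp, simp)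
qed

section \<open>The characterization of pure complexes\<close>

theorem theorem1p2:
  fixes \<Delta> :: "'n::finite set set" and d :: nat
  assumes "simplicial_complex \<Delta>" and "complex_dim \<Delta> = int d - 1"
  shows "(\<forall>k\<in>{1..d}. (sqfree_part (cover_ideal \<Delta> k) :: ('n, 'k::field) mpoly set)
              \<subseteq> facet_ideal_dual (skeleton (int d - int k) \<Delta>)) \<and>
    (pure_complex \<Delta> \<longleftrightarrow>
      (\<forall>k\<in>{1..d}. (sqfree_part (cover_ideal \<Delta> k) :: ('n, 'k) mpoly set)
              = facet_ideal_dual (skeleton (int d - int k) \<Delta>))) \<and>
    (2 \<le> d \<longrightarrow> (pure_complex \<Delta> \<longleftrightarrow>
      (\<exists>k\<in>{1..d}. k \<noteq> 1 \<and> (sqfree_part (cover_ideal \<Delta> k) :: ('n, 'k) mpoly set)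
              = facet_ideal_dual (skeleton (int d - int k) \<Delta>))))"
proof -
  let ?L = "\<lambda>k. sqfree_part (cover_ideal \<Delta> k) :: ('n, 'k) mpoly set"
  let ?D = "\<lambda>k. facet_ideal_dual (skeleton (int d - int k) \<Delta>) :: ('n, 'k) mpoly set"
  let ?T = "\<lambda>k. transversals (facets (skeleton (int d - int k) \<Delta>))"
  have le: "\<And>F. F \<in> \<Delta> \<Longrightarrow> card F \<le> d" and ex: "\<exists>F\<in>facets \<Delta>. card F = d"
    using complex_dim_eqD[OF assms] by auto
  then have ne: "facets \<Delta> \<noteq> {}" by blast
  have L: "?L k = polys_supported_in (cover_sets \<Delta> k)" if "k \<in> {1..d}" for k
    using that ne by (simp add: sqfree_part_cover_ideal)
  have sub: "?L k \<subseteq> ?D k" if "k \<in> {1..d}" for k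
    using that cover_sets_subset_transversals[OF assms(1) le]
    by (simp add: L facet_ideal_dual_eq polys_supported_in_subset_iff)
  have eq_iff: "?L k = ?D k \<longleftrightarrow> ?T k \<subseteq> cover_sets \<Delta> k" if "k \<in> {1..d}" for k
  proof -
    have "?L k = ?D k \<longleftrightarrow> ?D k \<subseteq> ?L k" using sub[OF that] by blast
    then show ?thesis using that by (simp add: L facet_ideal_dual_eq polys_supported_in_subset_iff)
  qed
  have pure_iff: "pure_complex \<Delta> \<longleftrightarrow> (\<forall>F\<in>facets \<Delta>. card F = d)"
  proof -
    obtain E where "E \<in> facets \<Delta>" "card E = d" using ex by blast
    moreover have "pure_complex \<Delta> \<longleftrightarrow> (\<forall>F\<in>facets \<Delta>. \<forall>G\<in>facets \<Delta>. card F = card G)"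
      by (simp add: pure_complex_def face_dim_def)
    ultimately show ?thesis by metis
  qed
  have eq_if_pure: "?L k = ?D k" if "pure_complex \<Delta>" "k \<in> {1..d}" for k
    using that pure_iff eq_iff transversals_subset_cover_sets[OF assms(1), of d k] by simp
  \<comment> \<open>The empty face is a facet only if it is the only face.\<close>
  have ne_facet: "F \<noteq> {}" if "F \<in> facets \<Delta>" "1 \<le> d" for F
  proof
    assume "F = {}"
    moreover obtain E where "E \<in> \<Delta>" "card E = d" using ex by (auto simp: facets_def)
    ultimately show False using that by (auto simp: facets_def)
  qed
  have pure_if_eq: "pure_complex \<Delta>" if "k \<in> {1..d}" "k \<noteq> 1" "?L k = ?D k" for k
  proof -
    have "card F = d" if F: "F \<in> facets \<Delta>" for F
    proof (rule order_antisym)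
      show "d \<le> card F"
        using F \<open>k \<in> {1..d}\<close> \<open>k \<noteq> 1\<close> \<open>?L k = ?D k\<close> eq_iff ne_facet
        by (intro pure_if_transversals_are_covers[OF assms(1), of k]) auto
      show "card F \<le> d" using F le by (auto simp: facets_def)
    qed
    then show ?thesis by (simp add: pure_iff)
  qed
  \<comment> \<open>Without an index \<open>k \<ge> 2\<close> the equalities give no information, but then \<open>\<Delta>\<close> consists of the empty
    face and points.\<close>
  have pure_small: "pure_complex \<Delta>" if "d < 2"
  proof -
    have "card F = d" if F: "F \<in> facets \<Delta>" for F
    proof -
      have "card F \<le> d" using F le by (auto simp: facets_def)
      moreover have "1 \<le> card F" if "1 \<le> d"
        using ne_facet[OF F that] by (simp add: Suc_le_eq card_gt_0_iff)
      ultimately show ?thesis using \<open>d < 2\<close> by linarith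
    qed
    then show ?thesis by (simp add: pure_iff)
  qed
  have "pure_complex \<Delta> \<longleftrightarrow> (\<forall>k\<in>{1..d}. ?L k = ?D k)"
  proof (cases "d < 2")
    case False
    then show ?thesis using eq_if_pure pure_if_eq[of d] by auto
  qed (use eq_if_pure pure_small in blast)
  moreover have "pure_complex \<Delta> \<longleftrightarrow> (\<exists>k\<in>{1..d}. k \<noteq> 1 \<and> ?L k = ?D k)" if "2 \<le> d"
    using that eq_if_pure[of d] pure_if_eq by (auto intro: bexI[of _ d])
  ultimately show ?thesis using sub by blast
qed

end
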